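(* Let $K$ be a field of characteristic $0$, let $X$ be a set, and let $\mathcal{A}s_1\langle X\rangle$ be the free first-type associative algebra generated by $X$. Let $\mathcal{A}s_1^{(-)}\langle X\rangle$ be the same vector space with the commutator operation $[a,b]=ab-ba$. Then $\mathcal{A}s_1^{(-)}\langle X\rangle$ satisfies the following identity of degree $5$ (for all elements $a,b,c,d,e$): $$[[[[a, b], c], d], e]-[[[[a, b], c], e], d]+[[[[a, b], d], c], e]-[[[[a,b], d], e], c]+[[[[a, b], e], c], d]+[[[[a, b], e], d], c]-[[[[a, c], b], d], e]+[[[[a, c], d], b], e]-[[[[a, d], b], c], e]+[[[[a, d], c], b], e]=0.$$
   Context: A first-type associative algebra is an associative (not necessarily unital) $K$-algebra satisfying the identity $abc+bac+acb+cab+bca+cba=0$; $\mathcal{A}s_1$ is the variety of all such algebras and $\mathcal{A}s_1\langle X\rangle$ is the free algebra of this variety on $X$. *)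

theory Defs
  imports "HOL-Algebra.Module" "HOL-Library.Poly_Mapping"
begin

text \<open>
  Associative, not necessarily unital algebras over a field. The record \<open>module\<close> is reused as the
  signature (its field \<open>one\<close> is never referred to); the scalars form a whole type of class
  \<^class>\<open>field\<close>.
\<close>

locale assoc_algebra = abelian_group A
  for A :: "('k::field, 'a, 'm) module_scheme" (structure) +
  assumes smult_closed [simp, intro]: "x \<in> carrier A \<Longrightarrow> r \<odot> x \<in> carrier A"
    and smult_add_left: "x \<in> carrier A \<Longrightarrow> (r + s) \<odot> x = r \<odot> x \<oplus> s \<odot> x"
    and smult_add_right:
      "\<lbrakk>x \<in> carrier A; y \<in> carrier A\<rbrakk> \<Longrightarrow> r \<odot> (x \<oplus> y) = r \<odot> x \<oplus> r \<odot> y"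
    and smult_smult: "x \<in> carrier A \<Longrightarrow> (r * s) \<odot> x = r \<odot> (s \<odot> x)"
    and smult_one [simp]: "x \<in> carrier A \<Longrightarrow> 1 \<odot> x = x"
    and mult_closed [simp, intro]:
      "\<lbrakk>x \<in> carrier A; y \<in> carrier A\<rbrakk> \<Longrightarrow> x \<otimes> y \<in> carrier A"
    and mult_assoc:
      "\<lbrakk>x \<in> carrier A; y \<in> carrier A; z \<in> carrier A\<rbrakk> \<Longrightarrow> (x \<otimes> y) \<otimes> z = x \<otimes> (y \<otimes> z)"
    and mult_add_left:
      "\<lbrakk>x \<in> carrier A; y \<in> carrier A; z \<in> carrier A\<rbrakk> \<Longrightarrow> (x \<oplus> y) \<otimes> z = x \<otimes> z \<oplus> y \<otimes> z"
    and mult_add_right: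
      "\<lbrakk>x \<in> carrier A; y \<in> carrier A; z \<in> carrier A\<rbrakk> \<Longrightarrow> z \<otimes> (x \<oplus> y) = z \<otimes> x \<oplus> z \<otimes> y"
    and mult_smult_left:
      "\<lbrakk>x \<in> carrier A; y \<in> carrier A\<rbrakk> \<Longrightarrow> (r \<odot> x) \<otimes> y = r \<odot> (x \<otimes> y)"
    and mult_smult_right:
      "\<lbrakk>x \<in> carrier A; y \<in> carrier A\<rbrakk> \<Longrightarrow> x \<otimes> (r \<odot> y) = r \<odot> (x \<otimes> y)"

locale first_type_algebra = assoc_algebra +
  assumes first_type:
    "\<lbrakk>a \<in> carrier A; b \<in> carrier A; c \<in> carrier A\<rbrakk> \<Longrightarrow>
      a \<otimes> b \<otimes> c \<oplus> b \<otimes> a \<otimes> c \<oplus> a \<otimes> c \<otimes> b \<oplus> c \<otimes> a \<otimes> b \<oplus> b \<otimes> c \<otimes> a \<oplus> c \<otimes> b \<otimes> a = \<zero>"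

definition algebra_hom ::
  "('k, 'a, 'm) module_scheme \<Rightarrow> ('k, 'b, 'n) module_scheme \<Rightarrow> ('a \<Rightarrow> 'b) set" where
  "algebra_hom A B = {h \<in> carrier A \<rightarrow> carrier B.
     (\<forall>x \<in> carrier A. \<forall>y \<in> carrier A. h (x \<oplus>\<^bsub>A\<^esub> y) = h x \<oplus>\<^bsub>B\<^esub> h y) \<and>
     (\<forall>r. \<forall>x \<in> carrier A. h (r \<odot>\<^bsub>A\<^esub> x) = r \<odot>\<^bsub>B\<^esub> h x) \<and>
     (\<forall>x \<in> carrier A. \<forall>y \<in> carrier A. h (x \<otimes>\<^bsub>A\<^esub> y) = h x \<otimes>\<^bsub>B\<^esub> h y)}"

definition commutator_algebra :: "('k, 'a, 'm) module_scheme \<Rightarrow> ('k, 'a, 'm) module_scheme" where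
  "commutator_algebra A = A\<lparr>mult := \<lambda>x y. x \<otimes>\<^bsub>A\<^esub> y \<ominus>\<^bsub>A\<^esub> y \<otimes>\<^bsub>A\<^esub> x\<rparr>"

text \<open>Bracket notation for the product of an algebra that is thought of as a commutator algebra. It is
  input syntax only, so such brackets are displayed as left-nested products.\<close>

abbreviation (input) bracket ::
  "('k, 'a, 'm) module_scheme \<Rightarrow> 'a \<Rightarrow> 'a \<Rightarrow> 'a" ("\<lbrakk>_, _\<rbrakk>\<index>") where
  "bracket L x y \<equiv> mult L x y"

subsection \<open>Noncommutative polynomials\<close>

text \<open>
  With concatenation as addition of words, \<^typ>\<open>'x list \<Rightarrow>\<^sub>0 'k\<close> is the free unital
  associative algebra, with the library's convolution product.
\<close>

instantiation list :: (type) monoid_add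
begin

definition zero_list :: "'a list" where "zero_list = []"
definition plus_list :: "'a list \<Rightarrow> 'a list \<Rightarrow> 'a list" where "plus_list = (@)"

instance
  by standard (simp_all add: zero_list_def plus_list_def)

end

definition free_words :: "'x set \<Rightarrow> 'x list set" where
  "free_words X = {w. w \<noteq> [] \<and> set w \<subseteq> X}"

definition free_assoc :: "'x set \<Rightarrow> ('x list \<Rightarrow>\<^sub>0 'k::field) set" where
  "free_assoc X = {p. Poly_Mapping.keys p \<subseteq> free_words X}"

abbreviation scale :: "'k::field \<Rightarrow> ('x list \<Rightarrow>\<^sub>0 'k) \<Rightarrow> ('x list \<Rightarrow>\<^sub>0 'k)" where
  "scale r p \<equiv> Poly_Mapping.map ((*) r) p"

definition sym3 :: "'r::ring \<Rightarrow> 'r \<Rightarrow> 'r \<Rightarrow> 'r" where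
  "sym3 a b c = a * b * c + b * a * c + a * c * b + c * a * b + b * c * a + c * b * a"

text \<open>The two-sided ideal of the non-unital algebra \<open>free_assoc X\<close> generated by all values of the
  defining identity.\<close>

inductive_set first_type_ideal :: "'x set \<Rightarrow> ('x list \<Rightarrow>\<^sub>0 'k::field) set" for X :: "'x set" where
  gen: "\<lbrakk>a \<in> free_assoc X; b \<in> free_assoc X; c \<in> free_assoc X\<rbrakk> \<Longrightarrow>
    sym3 a b c \<in> first_type_ideal X"
| zero: "0 \<in> first_type_ideal X"
| add: "\<lbrakk>p \<in> first_type_ideal X; q \<in> first_type_ideal X\<rbrakk> \<Longrightarrow> p + q \<in> first_type_ideal X"
| scale: "p \<in> first_type_ideal X \<Longrightarrow> scale r p \<in> first_type_ideal X"
| left: "\<lbrakk>p \<in> first_type_ideal X; a \<in> free_assoc X\<rbrakk> \<Longrightarrow> a * p \<in> first_type_ideal X"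
| right: "\<lbrakk>p \<in> first_type_ideal X; a \<in> free_assoc X\<rbrakk> \<Longrightarrow> p * a \<in> first_type_ideal X"

definition first_type_coset :: "'x set \<Rightarrow> ('x list \<Rightarrow>\<^sub>0 'k::field) \<Rightarrow> ('x list \<Rightarrow>\<^sub>0 'k) set" where
  "first_type_coset X p = (+) p ` first_type_ideal X"

subsection \<open>The free first-type associative algebra\<close>

text \<open>
  The quotient of \<open>free_assoc X\<close> by \<open>first_type_ideal X\<close>. The universal property among all first-type
  algebras over the same field is proved in \<open>free_first_type_algebra\<close>,
  \<open>free_first_type_universal\<close> and \<open>free_first_type_hom_unique\<close>.
\<close>

definition free_first_type :: "'x set \<Rightarrow> ('k::field, ('x list \<Rightarrow>\<^sub>0 'k) set) module" where
  "free_first_type X =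
    \<lparr>carrier = first_type_coset X ` free_assoc X,
     mult = \<lambda>A B. \<Union>p\<in>A. \<Union>q\<in>B. first_type_coset X (p * q),
     one = undefined,
     zero = first_type_coset X 0,
     add = \<lambda>A B. \<Union>p\<in>A. \<Union>q\<in>B. first_type_coset X (p + q),
     smult = \<lambda>r A. \<Union>p\<in>A. first_type_coset X (scale r p)\<rparr>"

definition free_generator :: "'x set \<Rightarrow> 'x \<Rightarrow> ('x list \<Rightarrow>\<^sub>0 'k::field) set" where
  "free_generator X x = first_type_coset X (Poly_Mapping.single [x] 1)"

lemma scale_conv_mult: "scale r p = Poly_Mapping.single 0 r * p"
  by (rule mult_map_scale_conv_mult)

lemma lookup_scale [simp]: "Poly_Mapping.lookup (scale r p) w = r * Poly_Mapping.lookup p w"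
  by (simp add: Poly_Mapping.map.rep_eq when_def)

lemma scale_add: "scale r (p + q) = scale r p + scale r q"
  by (rule poly_mapping_eqI) (simp add: lookup_add distrib_left)

lemma scale_add_left: "scale (r + s) p = scale r p + scale s p"
  by (rule poly_mapping_eqI) (simp add: lookup_add distrib_right)

lemma scale_diff: "scale r (p - q) = scale r p - scale r q"
  by (rule poly_mapping_eqI) (simp add: lookup_minus right_diff_distrib)

lemma scale_scale: "scale (r * s) p = scale r (scale s p)"
  by (rule poly_mapping_eqI) (simp add: mult.assoc)

lemma scale_zero: "scale 0 p = 0"
  by (rule poly_mapping_eqI) simp

lemma scale_zero_right: "scale r 0 = 0"
  by (rule poly_mapping_eqI) simp

lemma scale_one: "scale 1 p = p"
  by (rule poly_mapping_eqI) simp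

lemma scale_minus_one: "scale (- 1) p = - p"
  by (rule poly_mapping_eqI) simp

lemma scale_single: "scale r (Poly_Mapping.single w s) = Poly_Mapping.single w (r * s)"
  by (rule poly_mapping_eqI) (simp add: lookup_single when_def)

lemma mult_scale_left: "scale r p * q = scale r (p * q)"
  by (simp add: scale_conv_mult mult.assoc)

lemma scale_eq_right: "scale r p = p * Poly_Mapping.single 0 r"
proof -
  have "p = (\<Sum>w\<in>Poly_Mapping.keys p. Poly_Mapping.single w (Poly_Mapping.lookup p w))"
    by (rule poly_mapping_eqI)
      (simp add: lookup_sum lookup_single when_def in_keys_iff)
  then obtain A f where p: "p = (\<Sum>w\<in>A. Poly_Mapping.single w (f w))" by blast
  show ?thesis
    unfolding p scale_conv_mult sum_distrib_left sum_distrib_right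
    by (intro sum.cong refl) (simp add: mult_single mult.commute)
qed

lemma mult_scale_right: "p * scale r q = scale r (p * q)"
  by (simp add: scale_eq_right mult.assoc)

lemma free_assoc_zero: "0 \<in> free_assoc X"
  by (simp add: free_assoc_def)

lemma free_assoc_add: "\<lbrakk>p \<in> free_assoc X; q \<in> free_assoc X\<rbrakk> \<Longrightarrow> p + q \<in> free_assoc X"
  unfolding free_assoc_def using keys_add[of p q] by blast

lemma free_assoc_scale: "p \<in> free_assoc X \<Longrightarrow> scale r p \<in> free_assoc X"
  unfolding free_assoc_def by (auto simp: in_keys_iff subset_iff)

lemma free_assoc_uminus: "p \<in> free_assoc X \<Longrightarrow> - p \<in> free_assoc X"
  using free_assoc_scale[of p X "- 1"] by (simp add: scale_minus_one)

lemma free_assoc_mult: "\<lbrakk>p \<in> free_assoc X; q \<in> free_assoc X\<rbrakk> \<Longrightarrow> p * q \<in> free_assoc X"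
  unfolding free_assoc_def free_words_def
  using keys_mult[of p q] by (fastforce simp: plus_list_def)

lemma free_assoc_single: "w \<in> free_words X \<Longrightarrow> Poly_Mapping.single w r \<in> free_assoc X"
  by (simp add: free_assoc_def)

lemmas free_assoc_closed = free_assoc_zero free_assoc_add free_assoc_scale free_assoc_uminus
  free_assoc_mult

lemma first_type_ideal_subset: "p \<in> first_type_ideal X \<Longrightarrow> p \<in> free_assoc X"
  by (induction rule: first_type_ideal.induct) (simp_all add: free_assoc_closed sym3_def)

lemma first_type_ideal_uminus: "p \<in> first_type_ideal X \<Longrightarrow> - p \<in> first_type_ideal X"
  using first_type_ideal.scale[of p X "- 1"] by (simp add: scale_minus_one)

lemma first_type_ideal_diff:
  "\<lbrakk>p \<in> first_type_ideal X; q \<in> first_type_ideal X\<rbrakk> \<Longrightarrow> p - q \<in> first_type_ideal X"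
  using first_type_ideal.add[OF _ first_type_ideal_uminus, of p X q] by simp

lemma mem_first_type_coset: "q \<in> first_type_coset X p \<longleftrightarrow> q - p \<in> first_type_ideal X"
proof
  show "q \<in> first_type_coset X p" if "q - p \<in> first_type_ideal X"
    unfolding first_type_coset_def using that by (rule rev_image_eqI) simp
qed (auto simp: first_type_coset_def)

lemma first_type_coset_self: "p \<in> first_type_coset X p"
  by (simp add: mem_first_type_coset first_type_ideal.zero)

lemma first_type_coset_eq_iff:
  "first_type_coset X p = first_type_coset X q \<longleftrightarrow> p - q \<in> first_type_ideal X"
proof
  assume "first_type_coset X p = first_type_coset X q"
  then show "p - q \<in> first_type_ideal X"
    using first_type_coset_self[of p X] by (simp add: mem_first_type_coset)
next
  assume pq: "p - q \<in> first_type_ideal X"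
  have "r - p \<in> first_type_ideal X \<longleftrightarrow> r - q \<in> first_type_ideal X" for r
    using first_type_ideal.add[OF _ pq, of "r - p"] first_type_ideal_diff[OF _ pq, of "r - q"]
    by (auto simp: algebra_simps)
  then show "first_type_coset X p = first_type_coset X q"
    by (auto simp: mem_first_type_coset)
qed

lemma first_type_coset_nonempty: "first_type_coset X p \<noteq> {}"
  using first_type_coset_self by blast

lemma carrier_free_first_type: "carrier (free_first_type X) = first_type_coset X ` free_assoc X"
  by (simp add: free_first_type_def)

lemma zero_free_first_type: "\<zero>\<^bsub>free_first_type X\<^esub> = first_type_coset X 0"
  by (simp add: free_first_type_def)

lemma add_free_first_type:
  "first_type_coset X p \<oplus>\<^bsub>free_first_type X\<^esub> first_type_coset X q = first_type_coset X (p + q)"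
proof -
  have "first_type_coset X (p' + q') = first_type_coset X (p + q)"
    if "p' \<in> first_type_coset X p" "q' \<in> first_type_coset X q" for p' q'
    using that first_type_ideal.add[of "p' - p" X "q' - q"]
    by (simp add: mem_first_type_coset first_type_coset_eq_iff algebra_simps)
  then show ?thesis
    by (simp add: free_first_type_def first_type_coset_nonempty)
qed

lemma smult_free_first_type:
  "r \<odot>\<^bsub>free_first_type X\<^esub> first_type_coset X p = first_type_coset X (scale r p)"
proof -
  have "first_type_coset X (scale r p') = first_type_coset X (scale r p)"
    if "p' \<in> first_type_coset X p" for p'
    using that first_type_ideal.scale[of "p' - p" X r]
    by (simp add: mem_first_type_coset first_type_coset_eq_iff scale_diff)
  then show ?thesis
    by (simp add: free_first_type_def first_type_coset_nonempty)
qed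

lemma mult_free_first_type:
  assumes "p \<in> free_assoc X" "q \<in> free_assoc X"
  shows "first_type_coset X p \<otimes>\<^bsub>free_first_type X\<^esub> first_type_coset X q = first_type_coset X (p * q)"
proof -
  have "first_type_coset X (p' * q') = first_type_coset X (p * q)"
    if p': "p' \<in> first_type_coset X p" and q': "q' \<in> first_type_coset X q" for p' q'
  proof -
    have "q' = q + (q' - q)" by simp
    with q' assms(2) have "q' \<in> free_assoc X"
      by (metis mem_first_type_coset first_type_ideal_subset free_assoc_add)
    then have "(p' - p) * q' + p * (q' - q) \<in> first_type_ideal X"
      using p' q' assms(1)
      by (intro first_type_ideal.add first_type_ideal.left first_type_ideal.right)
        (simp_all add: mem_first_type_coset)
    then show ?thesis
      by (simp add: first_type_coset_eq_iff algebra_simps)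
  qed
  then show ?thesis
    by (simp add: free_first_type_def first_type_coset_nonempty)
qed

lemmas free_first_type_ops =
  carrier_free_first_type zero_free_first_type add_free_first_type smult_free_first_type
  mult_free_first_type

lemma uminus_in_carrier_ex:
  assumes "p \<in> free_assoc X"
  shows "\<exists>y\<in>free_assoc X. first_type_coset X (p + y) = first_type_coset X 0"
  using assms free_assoc_uminus by (intro bexI[of _ "- p"]) simp_all

theorem free_first_type_algebra:
  fixes X :: "'x set"
  shows "first_type_algebra (free_first_type X :: ('k::field, ('x list \<Rightarrow>\<^sub>0 'k) set) module)"
proof -
  let ?F = "free_first_type X :: ('k, ('x list \<Rightarrow>\<^sub>0 'k) set) module"
  have "abelian_group ?F"
    by (rule abelian_groupI)
      (auto simp: free_first_type_ops free_assoc_closed algebra_simps uminus_in_carrier_ex)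
  moreover have "assoc_algebra_axioms ?F"
    by unfold_locales
      (auto simp: free_first_type_ops free_assoc_closed scale_add scale_add_left
        scale_scale scale_one mult_scale_left mult_scale_right algebra_simps)
  moreover have "first_type_algebra_axioms ?F"
  proof
    fix a b c :: "('x list \<Rightarrow>\<^sub>0 'k) set"
    assume "a \<in> carrier ?F" "b \<in> carrier ?F"
      "c \<in> carrier ?F"
    then obtain p q r where "a = first_type_coset X p" "b = first_type_coset X q"
      "c = first_type_coset X r" "p \<in> free_assoc X" "q \<in> free_assoc X" "r \<in> free_assoc X"
      by (auto simp: carrier_free_first_type)
    then show "a \<otimes>\<^bsub>?F\<^esub> b \<otimes>\<^bsub>?F\<^esub> c \<oplus>\<^bsub>?F\<^esub>
       b \<otimes>\<^bsub>?F\<^esub> a \<otimes>\<^bsub>?F\<^esub> c \<oplus>\<^bsub>?F\<^esub>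
       a \<otimes>\<^bsub>?F\<^esub> c \<otimes>\<^bsub>?F\<^esub> b \<oplus>\<^bsub>?F\<^esub>
       c \<otimes>\<^bsub>?F\<^esub> a \<otimes>\<^bsub>?F\<^esub> b \<oplus>\<^bsub>?F\<^esub>
       b \<otimes>\<^bsub>?F\<^esub> c \<otimes>\<^bsub>?F\<^esub> a \<oplus>\<^bsub>?F\<^esub>
       c \<otimes>\<^bsub>?F\<^esub> b \<otimes>\<^bsub>?F\<^esub> a = \<zero>\<^bsub>?F\<^esub>"
      using first_type_ideal.gen[of p X q r]
      by (simp add: free_first_type_ops free_assoc_closed first_type_coset_eq_iff sym3_def)
  qed
  ultimately show ?thesis
    by (intro first_type_algebra.intro assoc_algebra.intro)
qed

subsection \<open>Universal property\<close>

fun word_value :: "('k, 'a, 'm) module_scheme \<Rightarrow> ('x \<Rightarrow> 'a) \<Rightarrow> 'x list \<Rightarrow> 'a" where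
  "word_value A f [] = undefined"
| "word_value A f [x] = f x"
| "word_value A f (x # y # w) = f x \<otimes>\<^bsub>A\<^esub> word_value A f (y # w)"

definition poly_value ::
  "('k::field, 'a, 'm) module_scheme \<Rightarrow> ('x \<Rightarrow> 'a) \<Rightarrow> ('x list \<Rightarrow>\<^sub>0 'k) \<Rightarrow> 'a" where
  "poly_value A f p = (\<Oplus>\<^bsub>A\<^esub>w\<in>Poly_Mapping.keys p. Poly_Mapping.lookup p w \<odot>\<^bsub>A\<^esub> word_value A f w)"

lemma free_assoc_induct [consumes 1, case_names zero single add]:
  assumes "p \<in> free_assoc X" and "P 0"
    and single: "\<And>w r. w \<in> free_words X \<Longrightarrow> P (Poly_Mapping.single w r)"
    and add: "\<And>p q. \<lbrakk>p \<in> free_assoc X; q \<in> free_assoc X; P p; P q\<rbrakk> \<Longrightarrow> P (p + q)"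
  shows "P p"
proof -
  have "P q" if "finite S" "S \<subseteq> free_words X" "Poly_Mapping.keys q \<subseteq> S" for S q
    using that
  proof (induction S arbitrary: q rule: finite_induct)
    case empty
    then show ?case using assms(2) by simp
  next
    case (insert w S)
    define q' where "q' = q - Poly_Mapping.single w (Poly_Mapping.lookup q w)"
    have keys: "Poly_Mapping.keys q' \<subseteq> S"
      using insert.prems(2) by (auto simp: q'_def in_keys_iff lookup_minus lookup_single when_def
        split: if_splits)
    then have "P q'"
      using insert by auto
    moreover have "q' \<in> free_assoc X"
      using keys insert.prems(1) by (auto simp: free_assoc_def)
    ultimately have "P (Poly_Mapping.single w (Poly_Mapping.lookup q w) + q')"
      using insert.prems(1) by (intro add single free_assoc_single) auto
    then show ?case by (simp add: q'_def)
  qed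
  from this[of "Poly_Mapping.keys p" p] assms(1) show ?thesis
    by (auto simp: free_assoc_def)
qed

context assoc_algebra
begin

lemma smult_zero_left: "x \<in> carrier A \<Longrightarrow> 0 \<odot> x = \<zero>"
  using smult_add_left[of x 0 0] by (metis add.l_cancel_one' add_0_left smult_closed)

lemma smult_zero_right: "r \<odot> \<zero> = \<zero>"
  using smult_add_right[of \<zero> \<zero> r] by (metis add.l_cancel_one' l_zero smult_closed zero_closed)

lemma smult_left_commute: "x \<in> carrier A \<Longrightarrow> r \<odot> (s \<odot> x) = s \<odot> (r \<odot> x)"
  by (metis smult_smult mult.commute)

lemma mult_zero_left: "x \<in> carrier A \<Longrightarrow> \<zero> \<otimes> x = \<zero>"
  using mult_smult_left[of \<zero> x 0] by (simp add: smult_zero_right smult_zero_left)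

lemma mult_zero_right: "x \<in> carrier A \<Longrightarrow> x \<otimes> \<zero> = \<zero>"
  using mult_smult_right[of x \<zero> 0] by (simp add: smult_zero_right smult_zero_left)

context
  fixes X :: "'x set" and f :: "'x \<Rightarrow> 'a"
  assumes f: "f \<in> X \<rightarrow> carrier A"
begin

lemma word_value_closed: "w \<in> free_words X \<Longrightarrow> word_value A f w \<in> carrier A"
  using f by (induction w rule: induct_list012) (auto simp: free_words_def)

lemma word_value_append:
  "\<lbrakk>u \<in> free_words X; v \<in> free_words X\<rbrakk> \<Longrightarrow>
    word_value A f (u @ v) = word_value A f u \<otimes> word_value A f v"
proof (induction u)
  case (Cons x u)
  show ?case
  proof (cases u)
    case Nil
    with Cons.prems show ?thesis
      by (cases v) (auto simp: free_words_def)
  next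
    case (Cons y w)
    with Cons.prems have u: "u \<in> free_words X" and x: "f x \<in> carrier A"
      using f by (auto simp: free_words_def)
    have "word_value A f (x # u @ v) = f x \<otimes> (word_value A f u \<otimes> word_value A f v)"
      using Cons.IH[OF u Cons.prems(2)] by (simp add: Cons)
    also have "\<dots> = (f x \<otimes> word_value A f u) \<otimes> word_value A f v"
      using x u Cons.prems(2) by (simp add: mult_assoc word_value_closed)
    finally show ?thesis by (simp add: Cons)
  qed
qed (simp add: free_words_def)

lemma term_closed: "w \<in> free_words X \<Longrightarrow> r \<odot> word_value A f w \<in> carrier A"
  by (simp add: word_value_closed)

lemma poly_value_superset:
  assumes "finite S" "Poly_Mapping.keys p \<subseteq> S" "S \<subseteq> free_words X"
  shows "poly_value A f p = (\<Oplus>w\<in>S. Poly_Mapping.lookup p w \<odot> word_value A f w)"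
  unfolding poly_value_def
proof (rule add.finprod_mono_neutral_cong_left[OF assms(1,2)])
  show "Poly_Mapping.lookup p w \<odot> word_value A f w = \<zero>" if "w \<in> S - Poly_Mapping.keys p" for w
    using that assms(3) by (auto simp: in_keys_iff smult_zero_left word_value_closed)
  show "(\<lambda>w. Poly_Mapping.lookup p w \<odot> word_value A f w) \<in> S \<rightarrow> carrier A"
    using assms(3) term_closed by auto
qed (rule refl)

lemma poly_value_closed: "p \<in> free_assoc X \<Longrightarrow> poly_value A f p \<in> carrier A"
  unfolding poly_value_def free_assoc_def by (rule finsum_closed) (auto intro: term_closed)

lemma poly_value_zero: "poly_value A f 0 = \<zero>"
  by (simp add: poly_value_def)

lemma poly_value_add:
  assumes "p \<in> free_assoc X" "q \<in> free_assoc X"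
  shows "poly_value A f (p + q) = poly_value A f p \<oplus> poly_value A f q"
proof -
  let ?S = "Poly_Mapping.keys p \<union> Poly_Mapping.keys q"
  have S: "finite ?S" "?S \<subseteq> free_words X"
    using assms by (auto simp: free_assoc_def)
  have "poly_value A f (p + q) =
      (\<Oplus>w\<in>?S. Poly_Mapping.lookup (p + q) w \<odot> word_value A f w)"
    by (rule poly_value_superset[OF S(1) keys_add S(2)])
  also have "\<dots> = (\<Oplus>w\<in>?S. Poly_Mapping.lookup p w \<odot> word_value A f w \<oplus>
      Poly_Mapping.lookup q w \<odot> word_value A f w)"
    using S(2) by (intro finsum_cong')
      (auto simp: lookup_add smult_add_left word_value_closed)
  also have "\<dots> = (\<Oplus>w\<in>?S. Poly_Mapping.lookup p w \<odot> word_value A f w) \<oplus>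
      (\<Oplus>w\<in>?S. Poly_Mapping.lookup q w \<odot> word_value A f w)"
    using S(2) by (intro finsum_addf) (auto intro: term_closed)
  also have "\<dots> = poly_value A f p \<oplus> poly_value A f q"
    using S by (simp add: poly_value_superset[of ?S])
  finally show ?thesis .
qed

lemma poly_value_single:
  assumes "w \<in> free_words X"
  shows "poly_value A f (Poly_Mapping.single w r) = r \<odot> word_value A f w"
  using assms poly_value_superset[of "{w}" "Poly_Mapping.single w r"]
  by (simp add: term_closed)

lemma poly_value_scale:
  assumes "p \<in> free_assoc X"
  shows "poly_value A f (scale r p) = r \<odot> poly_value A f p"
  using assms
proof (induction rule: free_assoc_induct)
  case zero
  show ?case by (simp add: scale_zero_right poly_value_zero smult_zero_right)
next
  case (single w s)
  then show ?case
    by (simp add: scale_single poly_value_single smult_smult word_value_closed)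
next
  case (add p q)
  then show ?case
    by (simp add: scale_add poly_value_add free_assoc_scale smult_add_right poly_value_closed)
qed

lemma poly_value_mult:
  assumes p: "p \<in> free_assoc X" and q: "q \<in> free_assoc X"
  shows "poly_value A f (p * q) = poly_value A f p \<otimes> poly_value A f q"
  using p
proof (induction rule: free_assoc_induct)
  case zero
  show ?case using q by (simp add: poly_value_zero mult_zero_left poly_value_closed)
next
  case (add p p')
  then show ?case using q
    by (simp add: distrib_right poly_value_add free_assoc_mult mult_add_left poly_value_closed)
next
  case u: (single u r)
  show ?case using q
  proof (induction rule: free_assoc_induct)
    case zero
    show ?case using u
      by (simp add: poly_value_zero mult_zero_right poly_value_closed free_assoc_single)
  next
    case (add q q')
    then show ?case using u
      by (simp add: distrib_left poly_value_add free_assoc_mult free_assoc_single mult_add_right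
        poly_value_closed)
  next
    case (single v s)
    have "u @ v \<in> free_words X"
      using u single by (auto simp: free_words_def)
    then show ?case using u single
      by (simp add: mult_single plus_list_def poly_value_single word_value_append smult_smult
        mult_smult_left mult_smult_right smult_left_commute word_value_closed)
  qed
qed

end

end

lemma (in first_type_algebra) poly_value_ideal:
  assumes f: "f \<in> X \<rightarrow> carrier A" and "p \<in> first_type_ideal X"
  shows "poly_value A f p = \<zero>"
  using assms(2)
proof (induction rule: first_type_ideal.induct)
  case (gen a b c)
  then show ?case
    using first_type[of "poly_value A f a" "poly_value A f b" "poly_value A f c"] f
    by (simp add: sym3_def poly_value_add poly_value_mult free_assoc_closed poly_value_closed)
qed (use f in \<open>simp_all add: poly_value_zero poly_value_add poly_value_scale poly_value_mult
  first_type_ideal_subset mult_zero_left mult_zero_right smult_zero_right poly_value_closed\<close>)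

theorem free_first_type_universal:
  fixes B :: "('k::field, 'b, 'm) module_scheme" and X :: "'x set"
  assumes "first_type_algebra B" and f: "f \<in> X \<rightarrow> carrier B"
  shows "\<exists>h \<in> algebra_hom (free_first_type X) B. \<forall>x\<in>X. h (free_generator X x) = f x"
proof -
  interpret B: first_type_algebra B by fact
  define h where "h S = poly_value B f (SOME p. p \<in> S \<inter> free_assoc X)" for S
  have h: "h (first_type_coset X p) = poly_value B f p" if p: "p \<in> free_assoc X" for p
  proof -
    let ?q = "SOME q. q \<in> first_type_coset X p \<inter> free_assoc X"
    have q: "?q \<in> first_type_coset X p \<inter> free_assoc X"
      by (rule someI[of _ p]) (simp add: p first_type_coset_self)
    then have "?q - p \<in> first_type_ideal X"
      by (simp add: mem_first_type_coset)
    then have "poly_value B f (p + (?q - p)) = poly_value B f p \<oplus>\<^bsub>B\<^esub> \<zero>\<^bsub>B\<^esub>"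
      using p by (simp only: B.poly_value_add[OF f] B.poly_value_ideal[OF f] first_type_ideal_subset)
    then show ?thesis
      using p f by (simp add: h_def B.poly_value_closed)
  qed
  have "h \<in> algebra_hom (free_first_type X) B"
    unfolding algebra_hom_def
    using f by (auto simp: free_first_type_ops free_assoc_closed h B.poly_value_closed
      B.poly_value_add B.poly_value_scale B.poly_value_mult)
  moreover have "h (free_generator X x) = f x" if "x \<in> X" for x
  proof -
    have "[x] \<in> free_words X" using that by (simp add: free_words_def)
    then show ?thesis
      using f that
      by (auto simp: free_generator_def h free_assoc_single B.poly_value_single[OF f] Pi_iff)
  qed
  ultimately show ?thesis by blast
qed

theorem free_first_type_hom_unique:
  fixes B :: "('k::field, 'b, 'm) module_scheme" and X :: "'x set"
  assumes "first_type_algebra B"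
    and h: "h \<in> algebra_hom (free_first_type X) B" and g: "g \<in> algebra_hom (free_first_type X) B"
    and eq: "\<And>x. x \<in> X \<Longrightarrow> h (free_generator X x) = g (free_generator X x)"
    and "a \<in> carrier (free_first_type X)"
  shows "h a = g a"
proof -
  let ?F = "free_first_type X :: ('k, ('x list \<Rightarrow>\<^sub>0 'k) set) module"
  have hom_add: "k (first_type_coset X (p + q)) = k (first_type_coset X p) \<oplus>\<^bsub>B\<^esub> k (first_type_coset X q)"
    if "k \<in> algebra_hom ?F B" "p \<in> free_assoc X" "q \<in> free_assoc X" for k p q
    using that by (auto simp: algebra_hom_def carrier_free_first_type simp flip: add_free_first_type)
  have hom_scale: "k (first_type_coset X (scale r p)) = r \<odot>\<^bsub>B\<^esub> k (first_type_coset X p)"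
    if "k \<in> algebra_hom ?F B" "p \<in> free_assoc X" for k p r
    using that by (auto simp: algebra_hom_def carrier_free_first_type simp flip: smult_free_first_type)
  have hom_mult: "k (first_type_coset X (p * q)) = k (first_type_coset X p) \<otimes>\<^bsub>B\<^esub> k (first_type_coset X q)"
    if "k \<in> algebra_hom ?F B" "p \<in> free_assoc X" "q \<in> free_assoc X" for k p q
    using that by (auto simp: algebra_hom_def carrier_free_first_type simp flip: mult_free_first_type)
  have word: "h (first_type_coset X (Poly_Mapping.single w 1)) =
      g (first_type_coset X (Poly_Mapping.single w 1))" if "w \<in> free_words X" for w
    using that
  proof (induction w)
    case (Cons x w)
    have x: "x \<in> X" "[x] \<in> free_words X" using Cons.prems by (auto simp: free_words_def)
    show ?case
    proof (cases "w = []")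
      case True
      then show ?thesis using eq[OF x(1)] by (simp add: free_generator_def)
    next
      case False
      with Cons.prems have w: "w \<in> free_words X" by (simp add: free_words_def)
      have "Poly_Mapping.single (x # w) (1::'k) = Poly_Mapping.single [x] 1 * Poly_Mapping.single w 1"
        by (simp add: mult_single plus_list_def)
      then show ?thesis
        using Cons.IH[OF w] eq[OF x(1)] x w
        by (simp add: hom_mult[OF h] hom_mult[OF g] free_assoc_single free_generator_def)
    qed
  qed (simp add: free_words_def)
  obtain p where p: "p \<in> free_assoc X" and a: "a = first_type_coset X p"
    using assms(5) by (auto simp: carrier_free_first_type)
  from p have "h (first_type_coset X p) = g (first_type_coset X p)"
  proof (induction rule: free_assoc_induct)
    case zero
    interpret B: first_type_algebra B by fact
    have "k (first_type_coset X 0) = \<zero>\<^bsub>B\<^esub>" if k: "k \<in> algebra_hom ?F B" for k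
    proof -
      have "k (first_type_coset X 0) \<in> carrier B"
        using k free_assoc_zero by (auto simp: algebra_hom_def carrier_free_first_type)
      moreover have "k (first_type_coset X 0) = 0 \<odot>\<^bsub>B\<^esub> k (first_type_coset X 0)"
        using hom_scale[OF k free_assoc_zero, of 0] by (simp only: scale_zero)
      ultimately show ?thesis by (simp add: B.smult_zero_left)
    qed
    from this[OF h] this[OF g] show ?case by simp
  next
    case (single w r)
    have "Poly_Mapping.single w r = scale r (Poly_Mapping.single w 1)"
      by (simp add: scale_single)
    then show ?case
      using hom_scale[OF h free_assoc_single[OF single(1)]]
        hom_scale[OF g free_assoc_single[OF single(1)]] word[OF single(1)]
      by metis
  next
    case (add p q)
    then show ?case by (simp add: hom_add[OF h] hom_add[OF g])
  qed
  then show ?thesis by (simp add: a)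
qed

end

theory Submission
  imports Defs
begin

text \<open>
  The quintic is symmetric in \<open>c\<close> and \<open>d\<close>. Put \<open>D y = [[y, c], d] + [[y, d], c]\<close>. Expanding brackets of
  brackets by the Leibniz rule shows, in every associative ring, that twice the quintic is
  \<open>[[D a, b], e] + [[a, D b], e] + [[a, b], D e] + D [[a, b], e]\<close>
  (lemma \<open>double_lie_quintic_eq\<close>). The defining identity says that \<open>D y\<close> equals
  \<open>-3 \<phi> y\<close> with \<open>\<phi> y = c y d + d y c\<close>. So it is enough that the sandwich map \<open>\<phi>\<close> satisfies, for all
  \<open>p\<close>, \<open>q\<close>, \<open>r\<close>, the Leibniz rule with the opposite sign,
  \<open>\<phi>(p) q r + p \<phi>(q) r + p q \<phi>(r) + \<phi>(p q r) = 0\<close>,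
  because \<open>[[a, b], e]\<close> is a signed sum of four products of three factors.

  By polarization (lemma \<open>anti_leibniz_defect_ideal\<close>) it suffices to take \<open>c = d = x\<close>. The defining
  identity then gives \<open>x w x = - x\<^sup>2 w - w x\<^sup>2\<close>, and the claim becomes
  \<open>s p q r + p s q r + p q s r + p q r s = 0\<close> with \<open>s = x\<^sup>2\<close>
  (lemma \<open>square_insertion_ideal\<close>). This holds because products of four factors, one of them a square, obey three more relations:
  \<open>(p q + q p) r s = 0\<close>, \<open>s r (p q + q p) = 0\<close>, and \<open>q s r\<close> anticommutes with \<open>p\<close>. Each of them comes from
  a consequence of the defining identity with two separate factors \<open>x\<close>: rewriting every \<open>x w x\<close> in it
  yields a consequence of the identity for \<open>s\<close> and three times the relation. Only the primes 2 and 3 are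
  ever divided out.

  Everything is computed with noncommutative polynomials; vanishing means membership in the ideal
  \<open>first_type_ideal X\<close>. Each membership is proved by displaying the polynomial, or a small multiple of it,
  as an explicit combination of members already known.
\<close>

section \<open>Division by 2 and 3 in the ideal\<close>

lemma triple_eq_scale: "p + p + p = scale 3 (p :: 'x list \<Rightarrow>\<^sub>0 'k::field_char_0)"
  by (rule poly_mapping_eqI) (simp add: lookup_add)

lemma double_eq_scale: "p + p = scale 2 (p :: 'x list \<Rightarrow>\<^sub>0 'k::field_char_0)"
  by (rule poly_mapping_eqI) (simp add: lookup_add)

lemma first_type_ideal_scaleD:
  assumes "scale r p \<in> first_type_ideal X" and "r \<noteq> 0"
  shows "p \<in> first_type_ideal X"
  using first_type_ideal.scale[OF assms(1), of "inverse r"] assms(2)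
  by (simp add: scale_scale[symmetric] scale_one)

lemma first_type_ideal_tripleD:
  "p + p + p \<in> first_type_ideal X \<Longrightarrow> p \<in> first_type_ideal X"
  for p :: "'x list \<Rightarrow>\<^sub>0 'k::field_char_0"
  using first_type_ideal_scaleD[of 3 p X] by (simp add: triple_eq_scale)

lemma first_type_ideal_doubleD:
  "p + p \<in> first_type_ideal X \<Longrightarrow> p \<in> first_type_ideal X"
  for p :: "'x list \<Rightarrow>\<^sub>0 'k::field_char_0"
  using first_type_ideal_scaleD[of 2 p X] by (simp add: double_eq_scale)

lemmas ideal_closed = first_type_ideal.gen first_type_ideal.add first_type_ideal_diff
  first_type_ideal.left first_type_ideal.right free_assoc_mult

section \<open>Relations with a square\<close>

text \<open>The derivative of \<open>x\<^sup>3\<close> in the direction \<open>w\<close>. Modulo the ideal it is zero, and so it serves as the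
  rewrite rule from \<open>x * w * x\<close> to \<open>- (x * x * w) - w * x * x\<close>.\<close>

definition cube_deriv :: "'r::ring \<Rightarrow> 'r \<Rightarrow> 'r" where
  "cube_deriv x w = x * x * w + x * w * x + w * x * x"

lemma cube_deriv_ideal:
  fixes x w :: "'x list \<Rightarrow>\<^sub>0 'k::field_char_0"
  assumes "x \<in> free_assoc X" "w \<in> free_assoc X"
  shows "cube_deriv x w \<in> first_type_ideal X"
proof (rule first_type_ideal_doubleD)
  have "cube_deriv x w + cube_deriv x w = sym3 x x w"
    by (simp add: cube_deriv_def sym3_def algebra_simps)
  then show "cube_deriv x w + cube_deriv x w \<in> first_type_ideal X"
    using assms by (simp add: first_type_ideal.gen)
qed

context
  fixes X :: "'x set" and x p q r :: "'x list \<Rightarrow>\<^sub>0 'k::field_char_0"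
  assumes x: "x \<in> free_assoc X"
    and p: "p \<in> free_assoc X" and q: "q \<in> free_assoc X" and r: "r \<in> free_assoc X"
begin

text \<open>Rewriting the sandwiches in \<open>sym3 p q x * r * x\<close> gives \<open>- sym3 p q (x * x) * r\<close> and, left over, the
  terms \<open>- p * q * r * x * x\<close> and \<open>- q * p * r * x * x\<close>, three times each: from each of the three positions
  of the inner \<open>x\<close> the square is moved once to the far right.\<close>

lemma jordan_square_right_ideal: "(p * q + q * p) * r * (x * x) \<in> first_type_ideal X"
  (is "?E \<in> _")
proof (rule first_type_ideal_tripleD)
  have "?E + ?E + ?E = p * q * cube_deriv x r + q * p * cube_deriv x r
      + p * cube_deriv x (q * r) + q * cube_deriv x (p * r)
      + cube_deriv x (p * q * r) + cube_deriv x (q * p * r)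
      - sym3 p q x * r * x - sym3 p q (x * x) * r"
    by (simp add: cube_deriv_def sym3_def algebra_simps)
  also have "\<dots> \<in> first_type_ideal X"
    using x p q r by (simp add: ideal_closed cube_deriv_ideal)
  finally show "?E + ?E + ?E \<in> first_type_ideal X" .
qed

text \<open>The mirror image, from \<open>x * r * sym3 p q x\<close>.\<close>

lemma jordan_square_left_ideal: "x * x * r * (p * q + q * p) \<in> first_type_ideal X"
  (is "?E \<in> _")
proof (rule first_type_ideal_tripleD)
  have "?E + ?E + ?E = cube_deriv x r * p * q + cube_deriv x r * q * p
      + cube_deriv x (r * p) * q + cube_deriv x (r * q) * p
      + cube_deriv x (r * p * q) + cube_deriv x (r * q * p)
      - x * r * sym3 p q x - r * sym3 p q (x * x)"
    by (simp add: cube_deriv_def sym3_def algebra_simps)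
  also have "\<dots> \<in> first_type_ideal X"
    using x p q r by (simp add: ideal_closed cube_deriv_ideal)
  finally show "?E + ?E + ?E \<in> first_type_ideal X" .
qed

text \<open>Here the two factors \<open>x\<close> meet in \<open>sym3 p (q * x * r) x\<close>. Rewriting produces
  \<open>- sym3 p (q * r) (x * x)\<close>, and again three copies of what remains.\<close>

lemma square_sandwich_anticommutes_ideal:
  "p * (q * (x * x) * r) + q * (x * x) * r * p \<in> first_type_ideal X"
  (is "?E \<in> _")
proof (rule first_type_ideal_tripleD)
  have "?E + ?E + ?E = p * q * cube_deriv x r + p * cube_deriv x q * r
      + q * cube_deriv x (r * p) + q * cube_deriv x r * p
      + cube_deriv x (p * q) * r + cube_deriv x q * r * p
      - sym3 p (q * x * r) x - sym3 p (q * r) (x * x)"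
    by (simp add: cube_deriv_def sym3_def algebra_simps)
  also have "\<dots> \<in> first_type_ideal X"
    using x p q r by (simp add: ideal_closed cube_deriv_ideal)
  finally show "?E + ?E + ?E \<in> first_type_ideal X" .
qed

end

section \<open>Sandwich maps on products of three factors\<close>

text \<open>With \<open>s = x * x\<close>, the elements \<open>sym3 p q s * r\<close> and \<open>sym3 p (q * r) s\<close> together contain \<open>s * p * q * r\<close>
  and \<open>p * s * q * r\<close> twice, but \<open>p * q * s * r\<close> and \<open>p * q * r * s\<close> only once. Anticommutation and the
  relation with the square on the right supply the second copies; all products in other orders then
  cancel against \<open>q * sym3 p r s\<close> and the relation with the square on the left.\<close>

lemma square_insertion_ideal:
  fixes x p q r :: "'x list \<Rightarrow>\<^sub>0 'k::field_char_0"
  assumes "x \<in> free_assoc X" "p \<in> free_assoc X" "q \<in> free_assoc X" "r \<in> free_assoc X"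
  shows "x * x * p * q * r + p * (x * x) * q * r + p * q * (x * x) * r + p * q * r * (x * x)
    \<in> first_type_ideal X"
  (is "?E \<in> _")
proof (rule first_type_ideal_doubleD)
  define k where "k = p * (q * (x * x) * r) + q * (x * x) * r * p"
  have "k \<in> first_type_ideal X"
    unfolding k_def by (rule square_sandwich_anticommutes_ideal[OF assms])
  have "?E + ?E = sym3 p q (x * x) * r + sym3 p (q * r) (x * x) - q * sym3 p r (x * x) + k
      + (p * q + q * p) * r * (x * x) - x * x * q * (p * r + r * p)"
    by (simp add: k_def sym3_def algebra_simps)
  also have "\<dots> \<in> first_type_ideal X"
    using assms \<open>k \<in> first_type_ideal X\<close>
      jordan_square_right_ideal[of x X p q r] jordan_square_left_ideal[of x X p r q]
    by (intro first_type_ideal.add first_type_ideal_diff) (simp_all add: ideal_closed)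
  finally show "?E + ?E \<in> first_type_ideal X" .
qed

text \<open>Zero exactly when \<open>f\<close> obeys, on \<open>p * q * r\<close>, the Leibniz rule with the opposite sign.\<close>

definition anti_leibniz_defect :: "('r::ring \<Rightarrow> 'r) \<Rightarrow> 'r \<Rightarrow> 'r \<Rightarrow> 'r \<Rightarrow> 'r" where
  "anti_leibniz_defect f p q r = f p * q * r + p * f q * r + p * q * f r + f (p * q * r)"

text \<open>Moving the factors \<open>x\<close> out of each sandwich puts the square \<open>x * x\<close> to the left and to the right of
  what it enclosed. Every one of the four insertion positions in \<open>p * q * r\<close> is reached twice.\<close>

lemma anti_leibniz_defect_ideal_diag:
  fixes x p q r :: "'x list \<Rightarrow>\<^sub>0 'k::field_char_0"
  assumes "x \<in> free_assoc X" "p \<in> free_assoc X" "q \<in> free_assoc X" "r \<in> free_assoc X"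
  shows "anti_leibniz_defect (\<lambda>y. x * y * x) p q r \<in> first_type_ideal X"
proof -
  define h where
    "h = x * x * p * q * r + p * (x * x) * q * r + p * q * (x * x) * r + p * q * r * (x * x)"
  have "h \<in> first_type_ideal X"
    unfolding h_def by (rule square_insertion_ideal[OF assms])
  have "anti_leibniz_defect (\<lambda>y. x * y * x) p q r =
      cube_deriv x p * q * r + p * cube_deriv x q * r + p * q * cube_deriv x r
      + cube_deriv x (p * q * r) - h - h"
    by (simp add: h_def anti_leibniz_defect_def cube_deriv_def algebra_simps)
  also have "\<dots> \<in> first_type_ideal X"
    using assms \<open>h \<in> first_type_ideal X\<close> by (simp add: ideal_closed cube_deriv_ideal)
  finally show ?thesis .
qed

lemma anti_leibniz_defect_ideal:
  fixes c d p q r :: "'x list \<Rightarrow>\<^sub>0 'k::field_char_0"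
  assumes "c \<in> free_assoc X" "d \<in> free_assoc X"
    and "p \<in> free_assoc X" "q \<in> free_assoc X" "r \<in> free_assoc X"
  shows "anti_leibniz_defect (\<lambda>y. c * y * d + d * y * c) p q r \<in> first_type_ideal X"
proof -
  have "anti_leibniz_defect (\<lambda>y. c * y * d + d * y * c) p q r =
      anti_leibniz_defect (\<lambda>y. (c + d) * y * (c + d)) p q r
      - anti_leibniz_defect (\<lambda>y. c * y * c) p q r - anti_leibniz_defect (\<lambda>y. d * y * d) p q r"
    by (simp add: anti_leibniz_defect_def algebra_simps)
  then show ?thesis
    using assms by (simp add: first_type_ideal_diff anti_leibniz_defect_ideal_diag free_assoc_add)
qed

section \<open>The quintic in terms of double commutators\<close>

definition commutator :: "'r::ring \<Rightarrow> 'r \<Rightarrow> 'r" where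
  "commutator x y = x * y - y * x"

definition double_commutator :: "'r::ring \<Rightarrow> 'r \<Rightarrow> 'r \<Rightarrow> 'r" where
  "double_commutator c d y = commutator (commutator y c) d + commutator (commutator y d) c"

text \<open>The four outer products have coefficient 1 and the two sandwiches \<open>-2\<close>. Completing to \<open>sym3\<close> makes
  the double commutator \<open>-3\<close> times a sandwich map, modulo the ideal.\<close>

lemma double_commutator_eq:
  "double_commutator c d y =
    sym3 c d y - (c * y * d + d * y * c) - (c * y * d + d * y * c) - (c * y * d + d * y * c)"
  by (simp add: double_commutator_def commutator_def sym3_def algebra_simps)

definition lie_quintic :: "'r::ring \<Rightarrow> 'r \<Rightarrow> 'r \<Rightarrow> 'r \<Rightarrow> 'r \<Rightarrow> 'r" where
  "lie_quintic a b c d e =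
    commutator (commutator (commutator (commutator a b) c) d) e
    - commutator (commutator (commutator (commutator a b) c) e) d
    + commutator (commutator (commutator (commutator a b) d) c) e
    - commutator (commutator (commutator (commutator a b) d) e) c
    + commutator (commutator (commutator (commutator a b) e) c) d
    + commutator (commutator (commutator (commutator a b) e) d) c
    - commutator (commutator (commutator (commutator a c) b) d) e
    + commutator (commutator (commutator (commutator a c) d) b) e
    - commutator (commutator (commutator (commutator a d) b) c) e
    + commutator (commutator (commutator (commutator a d) c) b) e"

text \<open>
  On the diagonal \<open>c = d = x\<close> the ten terms of the quintic collect, with \<open>u = [a, b]\<close>, into
  \<open>2 [[u, x], [x, e]] + 2 [[[u, e], x], x] + 2 [[[a, x], [x, b]], e]\<close>. Applying \<open>y \<mapsto> [[y, x], x]\<close> to a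
  bracket \<open>[y, z]\<close> gives the Leibniz terms and the cross term \<open>2 [[y, x], [z, x]]\<close>; eliminating both
  cross terms leaves the right-hand side. Both sides are symmetric and bilinear in \<open>c\<close>, \<open>d\<close>, so
  this is the polarized form of that computation.
\<close>

lemma double_lie_quintic_eq:
  fixes a b c d e :: "'r::ring"
  defines "D \<equiv> double_commutator c d"
  shows "lie_quintic a b c d e + lie_quintic a b c d e =
    commutator (commutator (D a) b) e + commutator (commutator a (D b)) e
    + commutator (commutator a b) (D e) + D (commutator (commutator a b) e)"
  unfolding D_def lie_quintic_def double_commutator_def commutator_def
  by (simp add: algebra_simps)

lemma free_assoc_diff: "\<lbrakk>u \<in> free_assoc X; v \<in> free_assoc X\<rbrakk> \<Longrightarrow> u - v \<in> free_assoc X"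
  using free_assoc_add[of u X "- v"] by (simp add: free_assoc_uminus)

lemma commutator_free_assoc:
  "\<lbrakk>u \<in> free_assoc X; v \<in> free_assoc X\<rbrakk> \<Longrightarrow> commutator u v \<in> free_assoc X"
  by (simp add: commutator_def free_assoc_mult free_assoc_diff)

lemma lie_quintic_ideal:
  fixes a b c d e :: "'x list \<Rightarrow>\<^sub>0 'k::field_char_0"
  assumes "a \<in> free_assoc X" "b \<in> free_assoc X" "c \<in> free_assoc X" "d \<in> free_assoc X"
    "e \<in> free_assoc X"
  shows "lie_quintic a b c d e \<in> first_type_ideal X"
proof (rule first_type_ideal_doubleD)
  define f where "f y = c * y * d + d * y * c" for y
  \<comment> \<open>The signs are those of the four words of \<open>[[a, b], e]\<close>.\<close>
  define F where "F = anti_leibniz_defect f a b e - anti_leibniz_defect f b a e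
    - anti_leibniz_defect f e a b + anti_leibniz_defect f e b a"
  have "F \<in> first_type_ideal X"
    using assms anti_leibniz_defect_ideal[of c X d]
    unfolding F_def f_def by (intro first_type_ideal.add first_type_ideal_diff) simp_all
  have D: "double_commutator c d y = sym3 c d y - f y - f y - f y" for y
    by (simp add: double_commutator_eq f_def)
  have "lie_quintic a b c d e + lie_quintic a b c d e =
      commutator (commutator (sym3 c d a) b) e + commutator (commutator a (sym3 c d b)) e
      + commutator (commutator a b) (sym3 c d e) + sym3 c d (commutator (commutator a b) e)
      - F - F - F"
    unfolding double_lie_quintic_eq D
    by (simp add: F_def f_def anti_leibniz_defect_def commutator_def algebra_simps)
  also have "\<dots> \<in> first_type_ideal X"
    using assms \<open>F \<in> first_type_ideal X\<close>
    by (simp add: commutator_def ideal_closed commutator_free_assoc[unfolded commutator_def])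
  finally show "lie_quintic a b c d e + lie_quintic a b c d e \<in> first_type_ideal X" .
qed

section \<open>Passage to the quotient\<close>

lemma minus_free_first_type:
  assumes "q \<in> free_assoc X"
  shows "first_type_coset X p \<ominus>\<^bsub>free_first_type X\<^esub> first_type_coset X q
    = first_type_coset X (p - q :: 'x list \<Rightarrow>\<^sub>0 'k::field)"
proof -
  interpret F: first_type_algebra "free_first_type X :: ('k, ('x list \<Rightarrow>\<^sub>0 'k) set) module"
    by (rule free_first_type_algebra)
  have "\<ominus>\<^bsub>free_first_type X\<^esub> first_type_coset X q = first_type_coset X (- q)"
    using assms free_assoc_uminus[OF assms]
    by (intro F.minus_equality) (simp_all add: free_first_type_ops)
  then show ?thesis
    by (simp add: a_minus_def add_free_first_type)
qed

lemma minus_commutator_algebra: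
  "x \<ominus>\<^bsub>commutator_algebra A\<^esub> y = x \<ominus>\<^bsub>A\<^esub> y"
  by (simp add: commutator_algebra_def a_minus_def a_inv_def)

lemma mult_commutator_algebra_free_first_type:
  assumes "p \<in> free_assoc X" "q \<in> free_assoc X"
  shows "first_type_coset X p \<otimes>\<^bsub>commutator_algebra (free_first_type X)\<^esub> first_type_coset X q
    = first_type_coset X (commutator p q :: 'x list \<Rightarrow>\<^sub>0 'k::field)"
  using assms
  by (simp add: commutator_algebra_def mult_free_first_type minus_free_first_type free_assoc_mult
    commutator_def)

theorem theorem2:
  fixes X :: "'x set"
    and L :: "('k::field_char_0, ('x list \<Rightarrow>\<^sub>0 'k) set) module" (structure)
  assumes "L = commutator_algebra (free_first_type X)"
    and "a \<in> carrier L" and "b \<in> carrier L" and "c \<in> carrier L"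
    and "d \<in> carrier L" and "e \<in> carrier L"
  shows "\<lbrakk>\<lbrakk>\<lbrakk>\<lbrakk>a, b\<rbrakk>, c\<rbrakk>, d\<rbrakk>, e\<rbrakk> \<ominus> \<lbrakk>\<lbrakk>\<lbrakk>\<lbrakk>a, b\<rbrakk>, c\<rbrakk>, e\<rbrakk>, d\<rbrakk>
       \<oplus> \<lbrakk>\<lbrakk>\<lbrakk>\<lbrakk>a, b\<rbrakk>, d\<rbrakk>, c\<rbrakk>, e\<rbrakk> \<ominus> \<lbrakk>\<lbrakk>\<lbrakk>\<lbrakk>a, b\<rbrakk>, d\<rbrakk>, e\<rbrakk>, c\<rbrakk>
       \<oplus> \<lbrakk>\<lbrakk>\<lbrakk>\<lbrakk>a, b\<rbrakk>, e\<rbrakk>, c\<rbrakk>, d\<rbrakk> \<oplus> \<lbrakk>\<lbrakk>\<lbrakk>\<lbrakk>a, b\<rbrakk>, e\<rbrakk>, d\<rbrakk>, c\<rbrakk>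
       \<ominus> \<lbrakk>\<lbrakk>\<lbrakk>\<lbrakk>a, c\<rbrakk>, b\<rbrakk>, d\<rbrakk>, e\<rbrakk> \<oplus> \<lbrakk>\<lbrakk>\<lbrakk>\<lbrakk>a, c\<rbrakk>, d\<rbrakk>, b\<rbrakk>, e\<rbrakk>
       \<ominus> \<lbrakk>\<lbrakk>\<lbrakk>\<lbrakk>a, d\<rbrakk>, b\<rbrakk>, c\<rbrakk>, e\<rbrakk> \<oplus> \<lbrakk>\<lbrakk>\<lbrakk>\<lbrakk>a, d\<rbrakk>, c\<rbrakk>, b\<rbrakk>, e\<rbrakk> = \<zero>"
proof -
  let ?F = "free_first_type X :: ('k, ('x list \<Rightarrow>\<^sub>0 'k) set) module"
  have carrier: "carrier L = first_type_coset X ` free_assoc X"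
    and add: "x \<oplus> y = x \<oplus>\<^bsub>?F\<^esub> y" and minus: "x \<ominus> y = x \<ominus>\<^bsub>?F\<^esub> y"
    and zero: "\<zero> = first_type_coset X 0" for x y
    by (simp_all add: assms(1) minus_commutator_algebra)
      (simp_all add: commutator_algebra_def free_first_type_ops)
  obtain a' b' c' d' e' where
    "a = first_type_coset X a'" "b = first_type_coset X b'" "c = first_type_coset X c'"
    "d = first_type_coset X d'" "e = first_type_coset X e'"
    and closed: "a' \<in> free_assoc X" "b' \<in> free_assoc X" "c' \<in> free_assoc X"
    "d' \<in> free_assoc X" "e' \<in> free_assoc X"
    using assms(2-6) unfolding carrier by blast
  then have "?thesis \<longleftrightarrow>
      first_type_coset X (lie_quintic a' b' c' d' e') = first_type_coset X 0"
    unfolding add minus zero lie_quintic_def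
    by (simp add: assms(1) mult_commutator_algebra_free_first_type commutator_free_assoc
      add_free_first_type minus_free_first_type free_assoc_add free_assoc_diff)
  also have "\<dots>"
    using lie_quintic_ideal[OF closed] by (simp add: first_type_coset_eq_iff)
  finally show ?thesis by blast
qed

end
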